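(* Let $\mathcal I$ be an ideal on $\mathbb N$, $X$ a Banach space, and $(\alpha_n^* )\in c_{0,\mathcal I}^{w^*}(X^* )$. Define $$T\colon X\to c_{0,\mathcal I},\qquad T(x)=(\alpha_n^*(x))_{n},\quad x\in X.$$ Then $T$ is compact if and only if the following conditions hold: (i) $(\|\alpha_n^*\|)_{n}\in c_{0,\mathcal I}$; and (ii) $\{\alpha_n^*: n\in\mathbb N\}$ is relatively norm compact in $X^*$.
   Context: An ideal on $\mathbb N$ is a collection of subsets of $\mathbb N$ containing $\emptyset$, closed under subsets and finite unions; every ideal is assumed to contain all finite sets. $c_{0,\mathcal I}$ is the closed subspace of $\ell_\infty$ (sup norm) of all bounded scalar sequences $(x_n)$ with $\{n:|x_n|\ge\varepsilon\}\in\mathcal I$ for every $\varepsilon>0$. $c_{0,\mathcal I}^{w^*}(X^* )$ is the set of all norm-bounded sequences $(x_n^* )$ in $X^*$ such that $\{n:|x_n^*(x)|\ge\varepsilon\}\in\mathcal I$ for every $x\in X$ and $\varepsilon>0$. *)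

theory Defs
  imports "HOL-Analysis.Analysis"
begin

(* Real and complex Banach spaces are treated together.  The types of class
   real_normed_field are, up to isometric isomorphism, the reals and the complex numbers;
   heine_borel holds for both.  A K-normed space is a type of class real_normed_vector with a
   K-scalar multiplication that extends scaleR and is compatible with the norm; it is Banach
   when the type is of class banach. *)

locale normed_space_over = vector_space scl
  for scl :: "'k::{real_normed_field,heine_borel} \<Rightarrow> 'a::real_normed_vector \<Rightarrow> 'a" +
  assumes scl_of_real: "scl (of_real r) x = r *\<^sub>R x"
    and norm_scl: "norm (scl c x) = norm c * norm x"

lemma normed_space_over_real:
  "normed_space_over (scaleR :: real \<Rightarrow> 'a::real_normed_vector \<Rightarrow> 'a)"
  by unfold_locales (simp_all add: scaleR_add_right scaleR_add_left)

lemma normed_space_over_complex: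
  "normed_space_over ((*) :: complex \<Rightarrow> complex \<Rightarrow> complex)"
  by unfold_locales (simp_all add: algebra_simps norm_mult scaleR_conv_of_real)

(* An ideal may be improper, that is, equal to UNIV. *)

definition ideal_on_nat :: "nat set set \<Rightarrow> bool" where
  "ideal_on_nat I \<longleftrightarrow>
     {} \<in> I \<and>
     (\<forall>A B. A \<in> I \<longrightarrow> B \<subseteq> A \<longrightarrow> B \<in> I) \<and>
     (\<forall>A B. A \<in> I \<longrightarrow> B \<in> I \<longrightarrow> A \<union> B \<in> I) \<and>
     (\<forall>A. finite A \<longrightarrow> A \<in> I)"

(* nat carries the discrete topology, so the type of bounded continuous functions on nat is
   the space of all bounded sequences with the supremum norm. *)

definition c0_ideal :: "nat set set \<Rightarrow> (nat \<Rightarrow>\<^sub>C 'k::real_normed_field) set" where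
  "c0_ideal I = {y. \<forall>\<epsilon>>0. {n. norm (apply_bcontfun y n) \<ge> \<epsilon>} \<in> I}"

(* The K-linear functionals among the bounded R-linear maps into K, with the operator norm
   of the blinfun type. *)

definition dual_space ::
  "('k::real_normed_field \<Rightarrow> 'a::real_normed_vector \<Rightarrow> 'a) \<Rightarrow> ('a \<Rightarrow>\<^sub>L 'k) set" where
  "dual_space scl = {f. \<forall>c x. blinfun_apply f (scl c x) = c * blinfun_apply f x}"

definition c0_ideal_wstar ::
  "nat set set \<Rightarrow> ('k::real_normed_field \<Rightarrow> 'a::real_normed_vector \<Rightarrow> 'a)
     \<Rightarrow> (nat \<Rightarrow> 'a \<Rightarrow>\<^sub>L 'k) set" where
  "c0_ideal_wstar I scl =
     {\<alpha>. range \<alpha> \<subseteq> dual_space scl \<and> bounded (range \<alpha>) \<and>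
         (\<forall>x. \<forall>\<epsilon>>0. {n. norm (blinfun_apply (\<alpha> n) x) \<ge> \<epsilon>} \<in> I)}"

(* Relative compactness inside the subspace Y: the closure is taken in Y. *)

definition relatively_compact_in :: "'a::topological_space set \<Rightarrow> 'a set \<Rightarrow> bool" where
  "relatively_compact_in Y S \<longleftrightarrow> S \<subseteq> Y \<and> compact (Y \<inter> closure S)"

definition compact_operator_into ::
  "'b::real_normed_vector set \<Rightarrow> ('a::real_normed_vector \<Rightarrow> 'b) \<Rightarrow> bool" where
  "compact_operator_into Y T \<longleftrightarrow>
     bounded_linear T \<and> range T \<subseteq> Y \<and> relatively_compact_in Y (T ` cball 0 1)"

(* Bcontfun is meaningful only on bounded sequences; the lemmas below show that it is applied
   to one whenever the functionals are norm-bounded. *)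

definition eval_operator ::
  "(nat \<Rightarrow> 'a \<Rightarrow>\<^sub>L 'k) \<Rightarrow> 'a::real_normed_vector \<Rightarrow> (nat \<Rightarrow>\<^sub>C 'k::real_normed_field)" where
  "eval_operator \<alpha> x = Bcontfun (\<lambda>n. blinfun_apply (\<alpha> n) x)"

lemma eval_operator_apply:
  assumes "\<alpha> \<in> c0_ideal_wstar I scl"
  shows "apply_bcontfun (eval_operator \<alpha> x) n = blinfun_apply (\<alpha> n) x"
proof -
  from assms obtain M where M: "\<And>n. norm (\<alpha> n) \<le> M"
    by (auto simp: c0_ideal_wstar_def bounded_iff)
  have "norm (blinfun_apply (\<alpha> n) x) \<le> M * norm x" for n
    by (rule order_trans[OF norm_blinfun]) (simp add: M mult_right_mono)
  then have "(\<lambda>n. blinfun_apply (\<alpha> n) x) \<in> bcontfun"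
    by (auto simp: bcontfun_def bounded_iff continuous_on_discrete)
  then show ?thesis
    by (simp add: eval_operator_def Bcontfun_inverse)
qed

lemma eval_operator_in_c0_ideal:
  assumes "\<alpha> \<in> c0_ideal_wstar I scl"
  shows "eval_operator \<alpha> x \<in> c0_ideal I"
  using assms eval_operator_apply[OF assms]
  by (simp add: c0_ideal_def c0_ideal_wstar_def)

lemma eval_operator_scl:
  assumes "\<alpha> \<in> c0_ideal_wstar I scl"
  shows "apply_bcontfun (eval_operator \<alpha> (scl c x)) n = c * apply_bcontfun (eval_operator \<alpha> x) n"
proof -
  have "\<alpha> n \<in> dual_space scl"
    using assms by (auto simp: c0_ideal_wstar_def)
  then show ?thesis
    by (simp add: dual_space_def eval_operator_apply[OF assms])
qed

end

theory Submission
  imports Defs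
begin

text \<open>Relative compactness is total boundedness, and for a bounded kernel
  \<open>f x n\<close> total boundedness of the rows in the supremum norm is equivalent to that of the columns:
  a finite net for the rows reduces the columns to points of a bounded set in a finite power of
  the scalar field.  Applied to the kernel \<open>\<alpha> n x\<close> on the unit ball this identifies compactness
  of \<open>T\<close> with condition (ii).  Condition (i) is a consequence: by a finite net, the functionals of
  norm at least \<open>\<epsilon>\<close> are large at one of finitely many points.\<close>

section \<open>Relative compactness as total boundedness\<close>

text \<open>\<open>Y \<inter> closure S\<close> is complete, so its compactness amounts to the
  existence of finite nets. Centres are taken in \<open>S\<close> so that they can later be pulled
  back to indices; closed balls are used because \<open>dist \<le> e\<close>, unlike a strict bound,
  can be tested pointwise in a supremum norm.\<close>

lemma relatively_compact_in_iff_totally_bounded: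
  fixes Y :: "'a::metric_space set"
  assumes "complete Y"
  shows "relatively_compact_in Y S \<longleftrightarrow>
    S \<subseteq> Y \<and> (\<forall>e>0. \<exists>F. finite F \<and> F \<subseteq> S \<and> S \<subseteq> (\<Union>x\<in>F. cball x e))"
proof (intro iffI conjI allI impI)
  assume rc: "relatively_compact_in Y S"
  then show SY: "S \<subseteq> Y"
    by (simp add: relatively_compact_in_def)
  fix e :: real assume "e > 0"
  have "Y \<inter> closure S \<subseteq> (\<Union>x\<in>S. ball x e)"
    using \<open>e > 0\<close> by (force simp: closure_approachable)
  moreover have "compact (Y \<inter> closure S)"
    using rc by (simp add: relatively_compact_in_def)
  ultimately obtain F where F: "F \<subseteq> S" "finite F" "Y \<inter> closure S \<subseteq> (\<Union>x\<in>F. ball x e)"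
    by (metis compactE_image open_ball)
  have "S \<subseteq> Y \<inter> closure S"
    using SY closure_subset by (rule Int_greatest)
  also have "\<dots> \<subseteq> (\<Union>x\<in>F. ball x e)"
    by (rule F(3))
  also have "\<dots> \<subseteq> (\<Union>x\<in>F. cball x e)"
    by (intro UN_mono order_refl ball_subset_cball)
  finally show "\<exists>F. finite F \<and> F \<subseteq> S \<and> S \<subseteq> (\<Union>x\<in>F. cball x e)"
    using F(1,2) by blast
next
  assume tb: "S \<subseteq> Y \<and> (\<forall>e>0. \<exists>F. finite F \<and> F \<subseteq> S \<and> S \<subseteq> (\<Union>x\<in>F. cball x e))"
  have "\<exists>F. finite F \<and> Y \<inter> closure S \<subseteq> (\<Union>x\<in>F. ball x e)" if "e > 0" for e
  proof -
    \<comment> \<open>A finite union of closed balls is closed, so the net for \<open>S\<close> also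
      covers its closure; halving the radius leaves room for the open balls of
      \<open>compact_eq_totally_bounded\<close>.\<close>
    obtain F where F: "finite F" "S \<subseteq> (\<Union>x\<in>F. cball x (e/2))"
      using tb \<open>e > 0\<close> by (meson half_gt_zero)
    then have "closure S \<subseteq> (\<Union>x\<in>F. cball x (e/2))"
      by (intro closure_minimal closed_UN) auto
    also have "\<dots> \<subseteq> (\<Union>x\<in>F. ball x e)"
      using \<open>e > 0\<close> by (intro UN_mono order_refl) auto
    finally show ?thesis
      using F(1) by blast
  qed
  moreover have "complete (Y \<inter> closure S)"
    using assms by (simp add: complete_Int_closed)
  ultimately have "compact (Y \<inter> closure S)"
    by (simp add: compact_eq_totally_bounded)
  with tb show "relatively_compact_in Y S"
    by (simp add: relatively_compact_in_def)
qed

section \<open>Uniform nets of a kernel and their transposition\<close>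

text \<open>A finite e-net of \<open>A\<close> for the pseudometric given by the supremum over
  \<open>B\<close>. The pointwise form avoids any supremum and makes sense for unbounded kernels
  too.\<close>

definition uniform_net :: "'a set \<Rightarrow> 'b set \<Rightarrow> ('a \<Rightarrow> 'b \<Rightarrow> 'k::real_normed_vector) \<Rightarrow> real \<Rightarrow> 'a set \<Rightarrow> bool"
  where "uniform_net A B f e F \<longleftrightarrow>
    finite F \<and> F \<subseteq> A \<and> (\<forall>a\<in>A. \<exists>a'\<in>F. \<forall>b\<in>B. norm (f a b - f a' b) \<le> e)"

lemma uniform_net_image_iff:
  fixes g :: "'a \<Rightarrow> 'c::metric_space"
  assumes "\<And>a a'. a \<in> A \<Longrightarrow> a' \<in> A \<Longrightarrow>
    dist (g a) (g a') \<le> e \<longleftrightarrow> (\<forall>b\<in>B. norm (f a b - f a' b) \<le> e)"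
  shows "(\<exists>F. finite F \<and> F \<subseteq> g ` A \<and> g ` A \<subseteq> (\<Union>x\<in>F. cball x e)) \<longleftrightarrow> (\<exists>F. uniform_net A B f e F)"
    (is "?L \<longleftrightarrow> ?R")
proof
  assume ?L
  then obtain C where C: "C \<subseteq> A" "finite C" "g ` A \<subseteq> (\<Union>x\<in>g ` C. cball x e)"
    by (metis finite_subset_image)
  have "\<exists>a'\<in>C. \<forall>b\<in>B. norm (f a b - f a' b) \<le> e" if "a \<in> A" for a
  proof -
    from C(3) that obtain a' where "a' \<in> C" "dist (g a) (g a') \<le> e"
      by (fastforce simp: dist_commute)
    then show ?thesis
      using assms C(1) that by blast
  qed
  with C show ?R
    by (auto simp: uniform_net_def)
next
  assume ?R
  then obtain F where F: "finite F" "F \<subseteq> A" "\<And>a. a \<in> A \<Longrightarrow> \<exists>a'\<in>F. \<forall>b\<in>B. norm (f a b - f a' b) \<le> e"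
    by (auto simp: uniform_net_def)
  have "\<exists>a'\<in>F. dist (g a') (g a) \<le> e" if "a \<in> A" for a
    using F assms that by (metis dist_commute subsetD)
  then have "g ` A \<subseteq> (\<Union>x\<in>g ` F. cball x e)"
    by auto
  with F show ?L
    by (intro exI[of _ "g ` F"]) auto
qed

text \<open>The points \<open>b\<close> become vectors of values indexed by the finite set
  \<open>A\<close>. Rounding each coordinate to a finite net of the compact ball of radius
  \<open>M\<close> leaves finitely many patterns, and two points with the same pattern are close on
  all of \<open>A\<close>.\<close>

lemma finite_uniform_net:
  fixes f :: "'a \<Rightarrow> 'b \<Rightarrow> 'k::{real_normed_vector,heine_borel}"
  assumes "finite A" and bd: "\<And>a b. a \<in> A \<Longrightarrow> b \<in> B \<Longrightarrow> norm (f a b) \<le> M" and "e > 0"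
  shows "\<exists>G. uniform_net B A (\<lambda>b a. f a b) e G"
proof -
  obtain N where N: "finite N" "cball (0::'k) M \<subseteq> (\<Union>x\<in>N. ball x (e/2))"
    using compact_cball[of "0::'k" M] \<open>e > 0\<close> unfolding compact_eq_totally_bounded
    by (meson half_gt_zero)
  have "\<forall>a\<in>A. \<forall>b\<in>B. \<exists>z\<in>N. dist z (f a b) < e/2"
    using N(2) bd by fastforce
  then obtain h where h: "\<And>a b. a \<in> A \<Longrightarrow> b \<in> B \<Longrightarrow> h a b \<in> N \<and> dist (h a b) (f a b) < e/2"
    by metis
  \<comment> \<open>\<open>restrict\<close> makes the rounding pattern extensional, so that all
    patterns lie in the finite set of extensional functions from \<open>A\<close> to
    \<open>N\<close>.\<close>
  define \<phi> where "\<phi> b = restrict (\<lambda>a. h a b) A" for b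
  have "\<phi> ` B \<subseteq> A \<rightarrow>\<^sub>E N"
    using h by (auto simp: \<phi>_def)
  then have "finite (\<phi> ` B)"
    using \<open>finite A\<close> N(1) by (meson finite_PiE finite_subset)
  \<comment> \<open>One representative in \<open>B\<close> for each pattern that occurs.\<close>
  then obtain G where G: "G \<subseteq> B" "finite G" "\<phi> ` B = \<phi> ` G"
    by (metis finite_subset_image order_refl)
  have "\<exists>b'\<in>G. \<forall>a\<in>A. norm (f a b - f a b') \<le> e" if "b \<in> B" for b
  proof -
    have "\<phi> b \<in> \<phi> ` G"
      using that by (simp flip: G(3))
    then obtain b' where b': "b' \<in> G" "\<phi> b = \<phi> b'"
      by (rule imageE)
    have "norm (f a b - f a b') \<le> e" if "a \<in> A" for a
    proof -
      have "h a b = h a b'"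
        using b'(2) that by (metis \<phi>_def restrict_apply')
      then have "dist (h a b) (f a b) < e/2" "dist (h a b) (f a b') < e/2"
        using h that \<open>b \<in> B\<close> b'(1) G(1) by (metis subsetD)+
      then have "dist (f a b) (f a b') < e"
        by (rule dist_triangle_half_r)
      then show ?thesis
        by (simp add: dist_norm)
    qed
    with b'(1) show ?thesis by blast
  qed
  with G show ?thesis
    by (auto simp: uniform_net_def)
qed

text \<open>Only this direction is proved: applied to the transposed kernel it gives the
  converse.\<close>

lemma uniform_net_transpose:
  fixes f :: "'a \<Rightarrow> 'b \<Rightarrow> 'k::{real_normed_vector,heine_borel}"
  assumes bd: "\<And>a b. a \<in> A \<Longrightarrow> b \<in> B \<Longrightarrow> norm (f a b) \<le> M"
    and net: "\<forall>e>0. \<exists>F. uniform_net A B f e F"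
  shows "\<forall>e>0. \<exists>G. uniform_net B A (\<lambda>b a. f a b) e G"
proof (intro allI impI)
  fix e :: real assume "e > 0"
  then obtain F where F: "finite F" "F \<subseteq> A" "\<And>a. a \<in> A \<Longrightarrow> \<exists>a'\<in>F. \<forall>b\<in>B. norm (f a b - f a' b) \<le> e/3"
    using net[rule_format, of "e/3"] by (auto simp: uniform_net_def)
  \<comment> \<open>\<open>G\<close> controls differences only at the finitely many rows in
    \<open>F\<close>; the net property of \<open>F\<close> extends this to every row.\<close>
  obtain G where G: "finite G" "G \<subseteq> B" "\<And>b. b \<in> B \<Longrightarrow> \<exists>b'\<in>G. \<forall>a\<in>F. norm (f a b - f a b') \<le> e/3"
  proof -
    have "\<exists>G. uniform_net B F (\<lambda>b a. f a b) (e/3) G"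
      using F(1,2) bd \<open>e > 0\<close> by (intro finite_uniform_net[of F B f M]) auto
    then show thesis
      using that unfolding uniform_net_def by blast
  qed
  have "\<exists>b'\<in>G. \<forall>a\<in>A. norm (f a b - f a b') \<le> e" if b: "b \<in> B" for b
  proof -
    obtain b' where b': "b' \<in> G" "\<And>a. a \<in> F \<Longrightarrow> norm (f a b - f a b') \<le> e/3"
      using G(3) b by blast
    have "norm (f a b - f a b') \<le> e" if "a \<in> A" for a
    proof -
      obtain a' where a': "a' \<in> F" "\<And>b. b \<in> B \<Longrightarrow> norm (f a b - f a' b) \<le> e/3"
        using F(3) \<open>a \<in> A\<close> by blast
      \<comment> \<open>Row \<open>a\<close> is replaced by its net row \<open>a'\<close> at both
        \<open>b\<close> and \<open>b'\<close>, at a cost of \<open>e/3\<close> each; the middle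
        term is the choice of \<open>b'\<close>.\<close>
      have "f a b - f a b' = (f a b - f a' b) + (f a' b - f a' b') - (f a b' - f a' b')"
        by simp
      also have "norm \<dots> \<le> norm (f a b - f a' b) + norm (f a' b - f a' b') + norm (f a b' - f a' b')"
        by (meson add_right_mono norm_triangle_ineq norm_triangle_ineq4 order_trans)
      also have "\<dots> \<le> e/3 + e/3 + e/3"
        using a' b' b G(2) by (intro add_mono) auto
      finally show ?thesis by simp
    qed
    with b'(1) show ?thesis by blast
  qed
  with G show "\<exists>G. uniform_net B A (\<lambda>b a. f a b) e G"
    by (auto simp: uniform_net_def)
qed

section \<open>The ambient spaces and the ideal\<close>

text \<open>Turns operator-norm distances into uniform distances over the unit ball, the form that
  \<open>uniform_net\<close> uses. The nontrivial direction rescales \<open>x\<close> to norm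
  one.\<close>

lemma norm_blinfun_le_iff:
  fixes f :: "'a::real_normed_vector \<Rightarrow>\<^sub>L 'b::real_normed_vector"
  assumes "0 \<le> e"
  shows "norm f \<le> e \<longleftrightarrow> (\<forall>x\<in>cball 0 1. norm (f x) \<le> e)"
proof
  assume f: "norm f \<le> e"
  show "\<forall>x\<in>cball 0 1. norm (f x) \<le> e"
  proof
    fix x :: 'a assume "x \<in> cball 0 1"
    then have "norm f * norm x \<le> e * 1"
      using f assms by (intro mult_mono) auto
    then show "norm (f x) \<le> e"
      using norm_blinfun[of f x] by simp
  qed
next
  assume *: "\<forall>x\<in>cball 0 1. norm (f x) \<le> e"
  show "norm f \<le> e"
  proof (rule norm_blinfun_bound[OF assms])
    fix x
    show "norm (f x) \<le> e * norm x"
    proof (cases "x = 0")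
      case False
      then have "norm (f (x /\<^sub>R norm x)) \<le> e"
        using * by simp
      with False show ?thesis
        by (simp add: blinfun.scaleR_right field_simps)
    qed simp
  qed
qed

lemma complete_UNIV_bcontfun:
  "complete (UNIV :: ('a::topological_space \<Rightarrow>\<^sub>C 'b::complete_space) set)"
proof (rule completeI)
  fix X :: "nat \<Rightarrow> 'a \<Rightarrow>\<^sub>C 'b"
  assume "Cauchy X"
  then have "uniformly_Cauchy_on UNIV (\<lambda>n. apply_bcontfun (X n))"
    unfolding Cauchy_def uniformly_Cauchy_on_def by (meson dist_fun_lt_imp_dist_val_lt)
  then obtain l where "uniform_limit UNIV (\<lambda>n. apply_bcontfun (X n)) l sequentially"
    using Cauchy_uniformly_convergent uniformly_convergent_on_def by blast
  then obtain L where "X \<longlonglongrightarrow> L"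
    by (rule uniform_limit_bcontfunE[OF _ sequentially_bot])
  then show "\<exists>L\<in>UNIV. X \<longlonglongrightarrow> L"
    by (intro bexI[of _ L] UNIV_I)
qed

text \<open>The library instance of \<^class>\<open>banach\<close> for bounded linear functions does not apply, because the
  sort of the scalar field does not entail \<^class>\<open>banach\<close>.\<close>

lemma complete_UNIV_blinfun:
  "complete (UNIV :: ('a::real_normed_vector \<Rightarrow>\<^sub>L 'b::{real_normed_vector,complete_space}) set)"
proof (rule completeI)
  fix X :: "nat \<Rightarrow> 'a \<Rightarrow>\<^sub>L 'b"
  assume X: "Cauchy X"
  obtain M where M: "\<And>n. norm (X n) \<le> M"
    using cauchy_imp_bounded[OF X] by (auto simp: bounded_iff)
  have "Cauchy (\<lambda>n. X n x)" for x
    by (rule bounded_linear.Cauchy[OF blinfun.bounded_linear_left X])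
  then have "\<exists>y. (\<lambda>n. X n x) \<longlonglongrightarrow> y" for x
    using Cauchy_convergent_iff convergent_def by blast
  then obtain g where g: "\<And>x. (\<lambda>n. X n x) \<longlonglongrightarrow> g x"
    by metis
  have "bounded_linear g"
  proof (rule bounded_linear_intro[where K = M])
    show "g (x + y) = g x + g y" for x y
      using tendsto_add[OF g[of x] g[of y]] g[of "x + y"]
      by (simp add: blinfun.add_right LIMSEQ_unique)
    show "g (r *\<^sub>R x) = r *\<^sub>R g x" for r x
      using tendsto_scaleR[OF tendsto_const g[of x], of r] g[of "r *\<^sub>R x"]
      by (simp add: blinfun.scaleR_right LIMSEQ_unique)
    show "norm (g x) \<le> norm x * M" for x
    proof (rule Lim_norm_ubound[OF sequentially_bot g], rule always_eventually, rule allI)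
      show "norm (X n x) \<le> norm x * M" for n
        using norm_blinfun[of "X n" x] mult_right_mono[OF M[of n] norm_ge_zero[of x]]
        by (simp add: mult.commute)
    qed
  qed
  then have G: "blinfun_apply (Blinfun g) = g"
    by (rule bounded_linear_Blinfun_apply)
  have "X \<longlonglongrightarrow> Blinfun g"
  proof (rule LIMSEQ_I)
    fix e :: real assume "e > 0"
    then obtain N where N: "\<And>m n. m \<ge> N \<Longrightarrow> n \<ge> N \<Longrightarrow> norm (X m - X n) < e/2"
      using CauchyD[OF X, of "e/2"] by auto
    \<comment> \<open>The Cauchy bound at a fixed \<open>x\<close> survives letting \<open>m\<close>
      tend to infinity, with a constant independent of \<open>x\<close>. The limit keeps only a
      non-strict bound, hence \<open>e/2\<close>.\<close>
    have "norm (X n - Blinfun g) \<le> e/2" if n: "n \<ge> N" for n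
    proof (rule norm_blinfun_bound)
      fix x
      have "(\<lambda>m. X n x - X m x) \<longlonglongrightarrow> X n x - g x"
        by (intro tendsto_intros g)
      moreover have "\<forall>\<^sub>F m in sequentially. norm (X n x - X m x) \<le> e/2 * norm x"
        using eventually_ge_at_top[of N]
      proof eventually_elim
        case (elim m)
        have "norm (X n x - X m x) \<le> norm (X n - X m) * norm x"
          using norm_blinfun[of "X n - X m" x] by (simp add: blinfun.diff_left)
        also have "\<dots> \<le> e/2 * norm x"
          using N[OF n elim] by (intro mult_right_mono) auto
        finally show ?case .
      qed
      ultimately have "norm (X n x - g x) \<le> e/2 * norm x"
        by (rule Lim_norm_ubound[OF sequentially_bot])
      then show "norm ((X n - Blinfun g) x) \<le> e/2 * norm x"
        by (simp add: blinfun.diff_left G)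
    qed (use \<open>e > 0\<close> in simp)
    then show "\<exists>N. \<forall>n\<ge>N. norm (X n - Blinfun g) < e"
      using \<open>e > 0\<close> by (intro exI[of _ N]) fastforce
  qed
  then show "\<exists>L\<in>UNIV. X \<longlonglongrightarrow> L"
    by blast
qed

text \<open>If \<open>z\<close> is within \<open>e/2\<close> of \<open>y\<close>, every index where
  \<open>y\<close> has norm at least \<open>e\<close> is one where \<open>z\<close> has norm at
  least \<open>e/2\<close>, and ideals are closed under subsets.\<close>

lemma closed_c0_ideal:
  assumes "ideal_on_nat I"
  shows "closed (c0_ideal I :: (nat \<Rightarrow>\<^sub>C 'k::real_normed_field) set)"
proof (subst closure_subset_eq[symmetric], rule subsetI)
  fix y :: "nat \<Rightarrow>\<^sub>C 'k" assume y: "y \<in> closure (c0_ideal I)"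
  have "{n. norm (y n) \<ge> e} \<in> I" if "e > 0" for e
  proof -
    obtain z where z: "z \<in> c0_ideal I" "dist z y < e/2"
      using y \<open>e > 0\<close> by (meson closure_approachable half_gt_zero)
    have "{n. norm (y n) \<ge> e} \<subseteq> {n. norm (z n) \<ge> e/2}"
    proof
      fix n assume "n \<in> {n. norm (y n) \<ge> e}"
      moreover have "norm (z n - y n) < e/2"
        using dist_bounded[of z n y] z(2) by (simp add: dist_norm)
      ultimately show "n \<in> {n. norm (z n) \<ge> e/2}"
        using norm_triangle_ineq2[of "y n" "z n"] by (simp add: norm_minus_commute)
    qed
    moreover have "{n. norm (z n) \<ge> e/2} \<in> I"
      using z(1) half_gt_zero[OF \<open>e > 0\<close>] unfolding c0_ideal_def by blast
    ultimately show ?thesis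
      using assms unfolding ideal_on_nat_def by blast
  qed
  then show "y \<in> c0_ideal I"
    by (simp add: c0_ideal_def)
qed

text \<open>For fixed \<open>c\<close> and \<open>x\<close>, both sides of the linearity equation
  are continuous in the functional, so the set is an intersection of closed equalizers.\<close>

lemma closed_dual_space: "closed (dual_space scl)"
  unfolding dual_space_def
  by (intro closed_Collect_all closed_Collect_eq continuous_on_mult_left
      linear_continuous_on blinfun.bounded_linear_left)

lemma ideal_on_nat_UN:
  assumes "ideal_on_nat I" "finite F" "\<And>x. x \<in> F \<Longrightarrow> S x \<in> I"
  shows "(\<Union>x\<in>F. S x) \<in> I"
  using assms(2,3)
proof (induction F)
  case empty
  then show ?case
    using assms(1) by (simp add: ideal_on_nat_def)
next
  case (insert x F)
  then have "S x \<in> I" "(\<Union>x\<in>F. S x) \<in> I"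
    by simp_all
  then have "S x \<union> (\<Union>x\<in>F. S x) \<in> I"
    using assms(1) unfolding ideal_on_nat_def by blast
  then show ?case
    by simp
qed

section \<open>The evaluation operator and the equivalence\<close>

lemma bounded_linear_eval_operator:
  assumes "\<alpha> \<in> c0_ideal_wstar I scl"
  shows "bounded_linear (eval_operator \<alpha>)"
proof -
  obtain M where M: "\<And>n. norm (\<alpha> n) \<le> M"
    using assms by (auto simp: c0_ideal_wstar_def bounded_iff)
  show ?thesis
  proof (rule bounded_linear_intro[where K = M])
    show "norm (eval_operator \<alpha> x) \<le> norm x * M" for x
    proof (rule norm_bound)
      show "norm (eval_operator \<alpha> x n) \<le> norm x * M" for n
        using norm_blinfun[of "\<alpha> n" x] mult_right_mono[OF M[of n] norm_ge_zero[of x]]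
        by (simp add: eval_operator_apply[OF assms] mult.commute)
    qed
  qed (auto intro!: bcontfun_eqI simp: eval_operator_apply[OF assms] blinfun.bilinear_simps)
qed

theorem theorem5p3:
  fixes I :: "nat set set"
    and scl :: "'k::{real_normed_field,heine_borel} \<Rightarrow> 'a::banach \<Rightarrow> 'a"
    and \<alpha> :: "nat \<Rightarrow> 'a \<Rightarrow>\<^sub>L 'k"
  assumes "ideal_on_nat I"
    and "normed_space_over scl"
    and "\<alpha> \<in> c0_ideal_wstar I scl"
  shows "compact_operator_into (c0_ideal I) (eval_operator \<alpha>) \<longleftrightarrow>
    (\<lambda>n. of_real (norm (\<alpha> n)) :: 'k) \<in> apply_bcontfun ` c0_ideal I \<and>
    relatively_compact_in (dual_space scl) (range \<alpha>)"
proof -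
  let ?T = "eval_operator \<alpha>" and ?B = "cball 0 1 :: 'a set"
  let ?f = "\<lambda>x n. blinfun_apply (\<alpha> n) x"
  let ?rows = "\<forall>e>0. \<exists>F. uniform_net ?B UNIV ?f e F"
  let ?cols = "\<forall>e>0. \<exists>F. uniform_net UNIV ?B (\<lambda>n x. ?f x n) e F"
  note T_apply = eval_operator_apply[OF assms(3)]
  obtain M where M: "\<And>n. norm (\<alpha> n) \<le> M"
    using assms(3) by (auto simp: c0_ideal_wstar_def bounded_iff)
  have M0: "0 \<le> M"
    using M[of 0] norm_ge_zero order_trans by blast

  have complete_c0: "complete (c0_ideal I :: (nat \<Rightarrow>\<^sub>C 'k) set)"
    using complete_closed_subset[OF closed_c0_ideal[OF assms(1)] subset_UNIV complete_UNIV_bcontfun] .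
  have complete_dual: "complete (dual_space scl)"
    using complete_closed_subset[OF closed_dual_space subset_UNIV complete_UNIV_blinfun] .

  \<comment> \<open>Sup-norm distance between images under \<open>T\<close> is the row distance of
    the kernel; \<open>dist_\<alpha>\<close> below does the same for the columns.\<close>
  have dist_T: "dist (?T x) (?T x') \<le> e \<longleftrightarrow> (\<forall>n\<in>UNIV. norm (?f x n - ?f x' n) \<le> e)" for x x' e
    using dist_bounded[of "?T x" _ "?T x'"] dist_bound[of "?T x" "?T x'" e]
    by (auto simp: T_apply dist_norm intro: order_trans)
  have "compact_operator_into (c0_ideal I) ?T \<longleftrightarrow> relatively_compact_in (c0_ideal I) (?T ` ?B)"
    using bounded_linear_eval_operator[OF assms(3)] eval_operator_in_c0_ideal[OF assms(3)]
    by (auto simp: compact_operator_into_def)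
  also have "\<dots> \<longleftrightarrow> ?rows"
    using eval_operator_in_c0_ideal[OF assms(3)]
    by (auto simp: relatively_compact_in_iff_totally_bounded[OF complete_c0]
        uniform_net_image_iff[where B = UNIV and f = ?f, OF dist_T])
  finally have compact_iff: "compact_operator_into (c0_ideal I) ?T \<longleftrightarrow> ?rows" .

  have dist_\<alpha>: "dist (\<alpha> n) (\<alpha> m) \<le> e \<longleftrightarrow> (\<forall>x\<in>?B. norm (?f x n - ?f x m) \<le> e)" if "e > 0" for n m e
    using norm_blinfun_le_iff[of e "\<alpha> n - \<alpha> m"] that by (simp add: dist_norm blinfun.diff_left)
  have "range \<alpha> \<subseteq> dual_space scl"
    using assms(3) by (simp add: c0_ideal_wstar_def)
  then have range_iff: "relatively_compact_in (dual_space scl) (range \<alpha>) \<longleftrightarrow> ?cols"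
    by (simp add: relatively_compact_in_iff_totally_bounded[OF complete_dual]
        uniform_net_image_iff[where B = ?B and f = "\<lambda>n x. ?f x n", OF dist_\<alpha>])

  \<comment> \<open>The uniform bound required for transposing, valid for both orders of the
    arguments.\<close>
  have f_bound: "norm (?f x n) \<le> M" if "x \<in> ?B" for x n
    using M norm_blinfun_le_iff[OF M0] that by blast
  have rows_cols: "?rows \<longleftrightarrow> ?cols"
    using uniform_net_transpose[of ?B UNIV ?f M] uniform_net_transpose[of UNIV ?B "\<lambda>n x. ?f x n" M]
      f_bound by blast

  have "(\<lambda>n. of_real (norm (\<alpha> n)) :: 'k) \<in> apply_bcontfun ` c0_ideal I" if ?rows
  proof -
    have in_I: "{n. e \<le> norm (\<alpha> n)} \<in> I" if "e > 0" for e
    proof -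
      obtain F where F: "finite F" "\<And>x. x \<in> ?B \<Longrightarrow> \<exists>x'\<in>F. \<forall>n. norm (?f x n - ?f x' n) \<le> e/3"
        using \<open>?rows\<close>[rule_format, of "e/3"] \<open>e > 0\<close> by (auto simp: uniform_net_def)
      \<comment> \<open>For \<open>n\<close> outside the union, all values at net points are below
        \<open>e/3\<close>, so the values on the whole ball are at most \<open>2*e/3\<close>.
        Passing to the operator norm preserves this non-strict bound, which is still strictly below
        \<open>e\<close>.\<close>
      have "{n. e \<le> norm (\<alpha> n)} \<subseteq> (\<Union>x\<in>F. {n. e/3 \<le> norm (?f x n)})"
      proof (rule subsetI, rule ccontr)
        fix n assume n: "n \<in> {n. e \<le> norm (\<alpha> n)}" "n \<notin> (\<Union>x\<in>F. {n. e/3 \<le> norm (?f x n)})"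
        have "norm (?f x n) \<le> 2*e/3" if x: "x \<in> ?B" for x
        proof -
          obtain x' where "x' \<in> F" "norm (?f x n - ?f x' n) \<le> e/3"
            using F(2)[OF x] by blast
          moreover from this n(2) have "norm (?f x' n) < e/3"
            by auto
          ultimately show ?thesis
            using norm_triangle_sub[of "?f x n" "?f x' n"] by linarith
        qed
        then have "norm (\<alpha> n) \<le> 2*e/3"
          using norm_blinfun_le_iff[of "2*e/3" "\<alpha> n"] \<open>e > 0\<close> by simp
        with n(1) \<open>e > 0\<close> show False
          by simp
      qed
      \<comment> \<open>Weak-star convergence along the ideal handles each net point, and the union
        is finite.\<close>
      moreover have "(\<Union>x\<in>F. {n. e/3 \<le> norm (?f x n)}) \<in> I"
      proof (rule ideal_on_nat_UN[OF assms(1) F(1)])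
        have "e/3 > 0"
          using \<open>e > 0\<close> by simp
        with assms(3) show "{n. e/3 \<le> norm (?f x n)} \<in> I" for x
          unfolding c0_ideal_wstar_def by blast
      qed
      ultimately show ?thesis
        using assms(1) unfolding ideal_on_nat_def by blast
    qed
    \<comment> \<open>Membership in \<open>c0_ideal I\<close> is a statement about elements of the
      bounded function type, so the sequence of norms must first be realised there; \<open>M\<close>
      bounds it.\<close>
    have "(\<lambda>n. of_real (norm (\<alpha> n)) :: 'k) \<in> bcontfun"
      using M by (auto simp: bcontfun_def bounded_iff continuous_on_discrete)
    then obtain y :: "nat \<Rightarrow>\<^sub>C 'k" where y: "apply_bcontfun y = (\<lambda>n. of_real (norm (\<alpha> n)))"
      by (metis Bcontfun_inverse)
    then have "y \<in> c0_ideal I"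
      using in_I by (simp add: c0_ideal_def)
    with y show ?thesis
      by (metis image_eqI)
  qed
  with compact_iff range_iff rows_cols show ?thesis
    by blast
qed

end
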